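(* Let $\Lambda=(\lambda_1,\ldots,\lambda_n)$ be the spectrum (eigenvalues listed with algebraic multiplicity) of an entrywise nonnegative $n\times n$ matrix $A$, where $\lambda_1=\max_i|\lambda_i|$ is the spectral radius of $A$. Then $(0,\lambda_1-\lambda_2,\ldots,\lambda_1-\lambda_n)$ is the spectrum of the $M$-matrix $\lambda_1 I-A$, and it satisfies Newton's inequalities: with $$c_j:=\binom{n}{j}^{-1}e_j(0,\lambda_1-\lambda_2,\ldots,\lambda_1-\lambda_n),\qquad j=0,\ldots,n,$$ one has $c_j^2\ge c_{j-1}c_{j+1}$ for $j=1,\ldots,n-1$.
   Context: $e_j$ denotes the $j$th elementary symmetric polynomial, with $e_0=1$. An $M$-matrix (possibly singular) is a real square matrix all of whose principal minors are nonnegative and all of whose off-diagonal entries are nonpositive. *)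

theory Defs
  imports
    "HOL-Computational_Algebra.Polynomial"
    "Jordan_Normal_Form.Spectral_Radius"
    "Jordan_Normal_Form.DL_Submatrix"
begin

abbreviation complex_mat :: "real mat \<Rightarrow> complex mat" where
  "complex_mat \<equiv> map_mat complex_of_real"

text \<open>\<^const>\<open>spectrum\<close> is the set of eigenvalues; here they are listed, in any order, with
  algebraic multiplicity.\<close>

definition is_spectrum :: "real mat \<Rightarrow> complex list \<Rightarrow> bool" where
  "is_spectrum A \<Lambda> \<longleftrightarrow> mset \<Lambda> = proots (char_poly (complex_mat A))"

definition M_matrix :: "real mat \<Rightarrow> bool" where
  "M_matrix A \<longleftrightarrow> square_mat A \<and>
     (\<forall>I \<subseteq> {..<dim_row A}. 0 \<le> det (submatrix A I I)) \<and>
     (\<forall>i<dim_row A. \<forall>j<dim_row A. i \<noteq> j \<longrightarrow> A $$ (i, j) \<le> 0)"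

definition elem_sym :: "'a :: comm_ring_1 list \<Rightarrow> nat \<Rightarrow> 'a" where
  "elem_sym xs j = (\<Sum>S | S \<subseteq> {..<length xs} \<and> card S = j. \<Prod>i\<in>S. xs ! i)"

lemma elem_sym_0: "elem_sym xs 0 = 1"
proof -
  have "{S. S \<subseteq> {..<length xs} \<and> card S = 0} = {{}}"
    using finite_subset by fastforce
  then show ?thesis
    by (simp add: elem_sym_def)
qed

definition newton_coeff :: "complex list \<Rightarrow> nat \<Rightarrow> complex" where
  "newton_coeff xs j = elem_sym xs j / of_nat (length xs choose j)"

text \<open>The inequalities only make sense when the coefficients are real, which is therefore part of
  the definition; the real parts below are then the coefficients themselves.\<close>

definition newton_inequalities :: "complex list \<Rightarrow> bool" where
  "newton_inequalities xs \<longleftrightarrow>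
     (\<forall>j\<le>length xs. newton_coeff xs j \<in> \<real>) \<and>
     (\<forall>j\<in>{1..length xs - 1}.
        (Re (newton_coeff xs j))\<^sup>2 \<ge> Re (newton_coeff xs (j - 1)) * Re (newton_coeff xs (j + 1)))"

end

theory Submission
  imports Defs
begin

text \<open>For an index set S write e(j) for the sum and c(j) for the mean of the principal minors of order j.
  Let all principal minors be positive and the off-diagonal entries be nonpositive. The key fact, proved together with
  Newton's inequalities by induction on S, is that e(j + 1) / e(j) does not decrease when an entry of
  the matrix is increased. For the matrix with row and column i deleted, it compares the minors that
  contain i with those that do not and, with Newton's inequality for the deleted matrix, bounds
  c(j + 2) of S by means of the deleted matrix (lemma newton_step_arith). Averaging this bound over i and
  using the Cauchy-Schwarz inequality gives Newton's inequality for S, while dropping its quadratic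
  term gives the key fact for S: the cofactors expand into cofactors of the deleted matrix with
  nonnegative weights.

  For a nonnegative matrix A, all principal minors of t I - A are positive when t exceeds the spectral
  radius: at the largest real zero of any of them, the vanishing minor forces every larger minor to
  vanish, so this zero is an eigenvalue of A. The singular case follows by letting t decrease to the
  spectral radius.\<close>

section \<open>Principal minors and cofactors over index sets\<close>

text \<open>Leibniz formula over an arbitrary index set. With entries given by a function, an index
  can be deleted without renumbering the others, which keeps the inductions on \<open>S\<close>
  simple.\<close>

definition pminor :: "('a \<Rightarrow> 'a \<Rightarrow> 'b::comm_ring_1) \<Rightarrow> 'a set \<Rightarrow> 'b" where
  "pminor a S = (\<Sum>p | p permutes S. of_int (sign p) * (\<Prod>i\<in>S. a i (p i)))"

text \<open>The derivative of the minor with respect to the entry at (k, l).\<close>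

definition cofactor_on :: "('a \<Rightarrow> 'a \<Rightarrow> 'b::comm_ring_1) \<Rightarrow> 'a set \<Rightarrow> 'a \<Rightarrow> 'a \<Rightarrow> 'b" where
  "cofactor_on a S k l =
     (\<Sum>p | p permutes S \<and> p k = l. of_int (sign p) * (\<Prod>i\<in>S - {k}. a i (p i)))"

lemma pminor_empty [simp]: "pminor a {} = 1"
  by (simp add: pminor_def)

lemma pminor_cong:
  assumes "\<And>i j. i \<in> S \<Longrightarrow> j \<in> S \<Longrightarrow> a i j = b i j"
  shows "pminor a S = pminor b S"
  unfolding pminor_def
  by (intro sum.cong refl arg_cong2[where f = "(*)"] prod.cong)
     (auto intro!: assms simp: permutes_in_image)

lemma pminor_of_real: "pminor (\<lambda>i j. of_real (a i j) :: complex) S = of_real (pminor a S)"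
  by (simp add: pminor_def)

lemma pminor_uminus:
  assumes "finite S"
  shows "pminor (\<lambda>i j. - a i j) S = (-1) ^ card S * pminor a S"
  using assms by (simp add: pminor_def prod_uminus sum_distrib_left mult_ac)

text \<open>Laplace expansion: the permutations are grouped by the image \<open>l\<close> of
  \<open>k\<close>.\<close>

lemma pminor_expand_row:
  assumes "finite S" "k \<in> S"
  shows "pminor a S = (\<Sum>l\<in>S. a k l * cofactor_on a S k l)"
proof -
  have "pminor a S = (\<Sum>l\<in>S. \<Sum>p | p \<in> {p. p permutes S} \<and> p k = l. of_int (sign p) * (\<Prod>i\<in>S. a i (p i)))"
    unfolding pminor_def
    by (rule sum.group[symmetric]) (use assms in \<open>auto simp: permutes_in_image finite_permutations\<close>)
  also have "\<dots> = (\<Sum>l\<in>S. a k l * cofactor_on a S k l)"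
    unfolding cofactor_on_def sum_distrib_left
    by (intro sum.cong refl) (use assms in \<open>auto simp: prod.remove[of S k] mult_ac\<close>)
  finally show ?thesis .
qed

lemma cofactor_on_diag:
  assumes "k \<in> S"
  shows "cofactor_on a S k k = pminor a (S - {k})"
proof -
  have "{p. p permutes S \<and> p k = k} = {p. p permutes S - {k}}"
    by (auto intro: permutes_subset simp: permutes_not_in)
       (auto simp: permutes_def)
  then show ?thesis
    by (simp add: cofactor_on_def pminor_def)
qed

text \<open>Expansion along column \<open>k\<close>: the permutations with \<open>p k = l\<close>
  are grouped by the preimage \<open>m\<close> of \<open>k\<close>. Composing with the transposition
  of \<open>k\<close> and \<open>m\<close> turns \<open>k\<close> into a fixed point, sends
  \<open>m\<close> to \<open>l\<close> and flips the sign, so that cofactors over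
  \<open>S - {k}\<close> remain.\<close>

lemma cofactor_on_rec:
  assumes "finite S" "k \<in> S" "l \<in> S" "k \<noteq> l"
  shows "cofactor_on a S k l = - (\<Sum>m\<in>S - {k}. a m k * cofactor_on a (S - {k}) m l)"
proof -
  let ?t = "\<lambda>p. of_int (sign p) * (\<Prod>i\<in>S - {k}. a i (p i))"
  let ?P = "{p. p permutes S \<and> p k = l}"
  have inv_in: "inv_into UNIV p k \<in> S - {k}" if "p \<in> ?P" for p
    using that assms by (auto simp: permutes_in_image permutes_inv permutes_inv_eq)
  have "cofactor_on a S k l = (\<Sum>m\<in>S - {k}. \<Sum>p | p \<in> ?P \<and> inv_into UNIV p k = m. ?t p)"
    unfolding cofactor_on_def
    by (rule sum.group[symmetric]) (use assms inv_in in \<open>auto simp: finite_permutations\<close>)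
  also have "\<dots> = (\<Sum>m\<in>S - {k}. - (a m k * cofactor_on a (S - {k}) m l))"
  proof (intro sum.cong refl)
    fix m assume m: "m \<in> S - {k}"
    let ?Q = "{q. q permutes S - {k} \<and> q m = l}"
    let ?u = "\<lambda>q. - (a m k * (of_int (sign q) * (\<Prod>i\<in>S - {k} - {m}. a i (q i))))"
    have "(\<Sum>p | p \<in> ?P \<and> inv_into UNIV p k = m. ?t p) = (\<Sum>q\<in>?Q. ?u q)"
    proof (rule sum.reindex_bij_witness[where i = "\<lambda>q. q \<circ> transpose k m" and j = "\<lambda>p. p \<circ> transpose k m"])
      fix p assume p: "p \<in> {p. p \<in> ?P \<and> inv_into UNIV p k = m}"
      then have pS: "p permutes S" and pk: "p k = l" and pm: "p m = k"
        by (auto simp: permutes_inv_eq)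
      have tS: "transpose k m permutes S"
        using m assms by (intro permutes_swap_id) auto
      show "p \<circ> transpose k m \<circ> transpose k m = p"
        by (simp add: comp_assoc)
      have "p \<circ> transpose k m permutes S - {k}"
        by (rule permutes_superset[OF permutes_compose[OF tS pS]]) (use pm in auto)
      then show "p \<circ> transpose k m \<in> ?Q"
        using pk by simp
      have "sign (p \<circ> transpose k m) = - sign p"
        using m sign_compose[OF pS[THEN permutes_imp_permutation[OF assms(1)]]
          tS[THEN permutes_imp_permutation[OF assms(1)]]]
        by (auto simp: sign_swap_id)
      moreover have "(\<Prod>i\<in>S - {k} - {m}. a i ((p \<circ> transpose k m) i)) = (\<Prod>i\<in>S - {k} - {m}. a i (p i))"
        by (intro prod.cong refl) (auto simp: transpose_def)
      moreover have "(\<Prod>i\<in>S - {k}. a i (p i)) = a m k * (\<Prod>i\<in>S - {k} - {m}. a i (p i))"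
        using m assms pm by (simp add: prod.remove)
      ultimately show "?u (p \<circ> transpose k m) = ?t p"
        by (simp add: mult_ac)
    next
      fix q assume q: "q \<in> ?Q"
      then have qS: "q permutes S" and qk: "q k = k" and qm: "q m = l"
        by (auto intro: permutes_subset simp: permutes_not_in)
      have tS: "transpose k m permutes S"
        using m assms by (intro permutes_swap_id) auto
      show "q \<circ> transpose k m \<circ> transpose k m = q"
        by (simp add: comp_assoc)
      show "q \<circ> transpose k m \<in> {p. p \<in> ?P \<and> inv_into UNIV p k = m}"
        using permutes_compose[OF tS qS] qk qm by (auto simp: permutes_inv_eq)
    qed
    also have "\<dots> = - (a m k * cofactor_on a (S - {k}) m l)"
      by (simp add: cofactor_on_def sum_distrib_left sum_negf)
    finally show "(\<Sum>p | p \<in> ?P \<and> inv_into UNIV p k = m. ?t p) = - (a m k * cofactor_on a (S - {k}) m l)" .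
  qed
  finally show ?thesis
    by (simp add: sum_negf)
qed

text \<open>Row \<open>i\<close> is expanded first, then each off-diagonal cofactor along column
  \<open>i\<close>. The double sum collects all that row and column \<open>i\<close> contribute off
  the diagonal; for M-matrices each of its terms is nonnegative.\<close>

lemma pminor_expand_diagonal_entry:
  assumes "finite S" "i \<in> S"
  shows "pminor a S = a i i * pminor a (S - {i})
           - (\<Sum>l\<in>S - {i}. \<Sum>m\<in>S - {i}. a i l * a m i * cofactor_on a (S - {i}) m l)"
proof -
  have "pminor a S = a i i * cofactor_on a S i i + (\<Sum>l\<in>S - {i}. a i l * cofactor_on a S i l)"
    using assms by (simp add: pminor_expand_row[of S i] sum.remove)
  also have "(\<Sum>l\<in>S - {i}. a i l * cofactor_on a S i l) =
      (\<Sum>l\<in>S - {i}. a i l * - (\<Sum>m\<in>S - {i}. a m i * cofactor_on a (S - {i}) m l))"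
    using assms by (intro sum.cong refl) (auto simp: cofactor_on_rec)
  finally show ?thesis
    using assms by (simp add: cofactor_on_diag sum_distrib_left sum_negf mult.assoc)
qed

text \<open>The row expansion and the cofactor recursion determine minors and cofactors from smaller
  index sets, so invariance of both under renaming follows by one induction, without conjugating
  permutations.\<close>

lemma pminor_reindex_aux:
  assumes "finite S" "inj_on f S"
  shows "pminor a (f ` S) = pminor (\<lambda>i j. a (f i) (f j)) S \<and>
    (\<forall>k\<in>S. \<forall>l\<in>S. cofactor_on a (f ` S) (f k) (f l) = cofactor_on (\<lambda>i j. a (f i) (f j)) S k l)"
  using assms
proof (induction S rule: finite_psubset_induct)
  case (psubset S)
  let ?b = "\<lambda>i j. a (f i) (f j)"
  have IH: "pminor a (f ` S - {f k}) = pminor ?b (S - {k})"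
      "\<And>m l. m \<in> S - {k} \<Longrightarrow> l \<in> S - {k} \<Longrightarrow>
        cofactor_on a (f ` S - {f k}) (f m) (f l) = cofactor_on ?b (S - {k}) m l"
    if "k \<in> S" for k
  proof -
    have eq: "f ` S - {f k} = f ` (S - {k})"
      using psubset.prems that by (auto simp: inj_on_def)
    have "S - {k} \<subset> S" "inj_on f (S - {k})"
      using psubset.prems that by (auto simp: inj_on_def)
    note * = psubset.IH[OF this]
    show "pminor a (f ` S - {f k}) = pminor ?b (S - {k})"
      using * by (simp add: eq)
    show "cofactor_on a (f ` S - {f k}) (f m) (f l) = cofactor_on ?b (S - {k}) m l"
      if "m \<in> S - {k}" "l \<in> S - {k}" for m l
      using * that by (simp add: eq)
  qed
  have cof: "cofactor_on a (f ` S) (f k) (f l) = cofactor_on ?b S k l" if "k \<in> S" "l \<in> S" for k l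
  proof (cases "k = l")
    case True
    then show ?thesis
      using that IH(1) by (simp add: cofactor_on_diag)
  next
    case False
    have eq: "f ` S - {f k} = f ` (S - {k})" and inj: "inj_on f (S - {k})"
      using psubset.prems that by (auto simp: inj_on_def)
    have "f k \<noteq> f l"
      using False that psubset.prems by (auto simp: inj_on_def)
    then have "cofactor_on a (f ` S) (f k) (f l)
        = - (\<Sum>m\<in>f ` (S - {k}). a m (f k) * cofactor_on a (f ` S - {f k}) m (f l))"
      using that psubset.hyps by (simp add: cofactor_on_rec eq)
    also have "\<dots> = - (\<Sum>m\<in>S - {k}. ?b m k * cofactor_on ?b (S - {k}) m l)"
      using that False IH(2)[OF that(1)] by (simp add: sum.reindex[OF inj])
    finally show ?thesis
      using that False psubset.hyps by (simp add: cofactor_on_rec)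
  qed
  have "pminor a (f ` S) = pminor ?b S"
  proof (cases "S = {}")
    case False
    then obtain k where k: "k \<in> S"
      by blast
    then show ?thesis
      using psubset.hyps cof
      by (simp add: pminor_expand_row[of _ k] pminor_expand_row[of _ "f k"] sum.reindex[OF psubset.prems])
  qed simp
  then show ?case
    using cof by blast
qed

lemmas pminor_reindex = pminor_reindex_aux[THEN conjunct1]

text \<open>Multiplying out each product, \<open>T\<close> is the set of rows from which the entry
  of \<open>a\<close> is chosen. The remaining diagonal factors vanish unless the permutation fixes
  every index outside \<open>T\<close>, which leaves the permutations of \<open>T\<close>.\<close>

lemma pminor_add_scalar:
  assumes "finite S"
  shows "pminor (\<lambda>i j. (if i = j then x else 0) + a i j) S
       = (\<Sum>T\<in>Pow S. x ^ card (S - T) * pminor a T)"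
proof -
  let ?d = "\<lambda>i j. if i = j then x else 0"
  have "pminor (\<lambda>i j. ?d i j + a i j) S = (\<Sum>T\<in>Pow S. \<Sum>p | p permutes S.
          of_int (sign p) * ((\<Prod>i\<in>S - T. ?d i (p i)) * (\<Prod>i\<in>T. a i (p i))))"
    unfolding pminor_def
    by (subst sum.swap) (simp add: assms prod_add add.commute[of "?d _ _"] sum_distrib_left mult_ac)
  also have "\<dots> = (\<Sum>T\<in>Pow S. x ^ card (S - T) * pminor a T)"
  proof (intro sum.cong refl)
    fix T assume T: "T \<in> Pow S"
    have "(\<Sum>p | p permutes S. of_int (sign p) * ((\<Prod>i\<in>S - T. ?d i (p i)) * (\<Prod>i\<in>T. a i (p i))))
        = (\<Sum>p | p permutes T. of_int (sign p) * (x ^ card (S - T) * (\<Prod>i\<in>T. a i (p i))))"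
    proof (rule sum.mono_neutral_cong_right)
      show "finite {p. p permutes S}"
        by (simp add: assms finite_permutations)
      show "{p. p permutes T} \<subseteq> {p. p permutes S}"
        using T by (auto intro: permutes_subset)
      show "\<forall>p\<in>{p. p permutes S} - {p. p permutes T}.
          of_int (sign p) * ((\<Prod>i\<in>S - T. ?d i (p i)) * (\<Prod>i\<in>T. a i (p i))) = 0"
      proof
        fix p assume p: "p \<in> {p. p permutes S} - {p. p permutes T}"
        then have "p permutes S" "\<not> p permutes T"
          by auto
        then obtain i where i: "i \<in> S - T" "p i \<noteq> i"
          using permutes_superset[of p S T] by blast
        then have "(\<Prod>i\<in>S - T. ?d i (p i)) = 0"
          using assms by (intro prod_zero bexI[OF _ i(1)]) auto
        then show "of_int (sign p) * ((\<Prod>i\<in>S - T. ?d i (p i)) * (\<Prod>i\<in>T. a i (p i))) = 0"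
          by simp
      qed
      show "of_int (sign p) * ((\<Prod>i\<in>S - T. ?d i (p i)) * (\<Prod>i\<in>T. a i (p i)))
          = of_int (sign p) * (x ^ card (S - T) * (\<Prod>i\<in>T. a i (p i)))"
        if "p \<in> {p. p permutes T}" for p
        using that by (simp add: permutes_not_in)
    qed
    then show "(\<Sum>p | p permutes S. of_int (sign p) * ((\<Prod>i\<in>S - T. ?d i (p i)) * (\<Prod>i\<in>T. a i (p i))))
        = x ^ card (S - T) * pminor a T"
      by (simp add: pminor_def sum_distrib_left mult_ac)
  qed
  finally show ?thesis .
qed

lemma det_eq_pminor:
  assumes "A \<in> carrier_mat n n"
  shows "det A = pminor (\<lambda>i j. A $$ (i, j)) {..<n}"
  using det_def'[OF assms] by (simp add: pminor_def atLeast0LessThan)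

section \<open>Sums of principal minors of fixed order\<close>

definition minor_sum :: "('a \<Rightarrow> 'a \<Rightarrow> 'b::comm_ring_1) \<Rightarrow> 'a set \<Rightarrow> nat \<Rightarrow> 'b" where
  "minor_sum a S j = (\<Sum>T | T \<subseteq> S \<and> card T = j. pminor a T)"

definition minor_sum_at :: "('a \<Rightarrow> 'a \<Rightarrow> 'b::comm_ring_1) \<Rightarrow> 'a set \<Rightarrow> 'a \<Rightarrow> nat \<Rightarrow> 'b" where
  "minor_sum_at a S i j = (\<Sum>T | T \<subseteq> S \<and> card T = j \<and> i \<in> T. pminor a T)"

text \<open>The derivative of \<open>minor_sum a S j\<close> with respect to the entry at (k, l):
  only minors that contain both indices depend on this entry.\<close>

definition cofactor_sum :: "('a \<Rightarrow> 'a \<Rightarrow> 'b::comm_ring_1) \<Rightarrow> 'a set \<Rightarrow> nat \<Rightarrow> 'a \<Rightarrow> 'a \<Rightarrow> 'b" where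
  "cofactor_sum a S j k l =
     (\<Sum>T | T \<subseteq> S \<and> card T = j \<and> k \<in> T \<and> l \<in> T. cofactor_on a T k l)"

lemma minor_sum_eq_0:
  assumes "finite S" "card S < j"
  shows "minor_sum a S j = 0"
proof -
  have "{T. T \<subseteq> S \<and> card T = j} = {}"
    using assms(2) by (auto dest!: card_mono[OF assms(1)])
  then show ?thesis
    unfolding minor_sum_def by (simp only: sum.empty)
qed

lemma minor_sum_split:
  assumes "finite S"
  shows "minor_sum a S j = minor_sum a (S - {i}) j + minor_sum_at a S i j"
proof -
  have "{T. T \<subseteq> S \<and> card T = j} =
      {T. T \<subseteq> S - {i} \<and> card T = j} \<union> {T. T \<subseteq> S \<and> card T = j \<and> i \<in> T}"
    by auto
  then show ?thesis
    unfolding minor_sum_def minor_sum_at_def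
    by (simp only:) (rule sum.union_disjoint, use assms in auto)
qed

text \<open>The predicates \<open>P\<close> and \<open>Q\<close> leave room for a second prescribed
  index, as needed for \<open>cofactor_sum\<close>.\<close>

lemma sum_subsets_containing:
  assumes "finite S" "i \<in> S" "\<And>T. Q (insert i T) \<longleftrightarrow> P T"
  shows "(\<Sum>T | T \<subseteq> S \<and> card T = Suc j \<and> i \<in> T \<and> Q T. f T)
       = (\<Sum>T | T \<subseteq> S - {i} \<and> card T = j \<and> P T. f (insert i T))"
proof (rule sum.reindex_bij_witness[where i = "insert i" and j = "\<lambda>T. T - {i}"])
  fix T assume T: "T \<in> {T. T \<subseteq> S \<and> card T = Suc j \<and> i \<in> T \<and> Q T}"
  then have "finite T"
    using assms finite_subset by blast
  with T assms(3)[of "T - {i}"] show "T - {i} \<in> {T. T \<subseteq> S - {i} \<and> card T = j \<and> P T}"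
    by (auto simp: insert_absorb)
next
  fix T assume T: "T \<in> {T. T \<subseteq> S - {i} \<and> card T = j \<and> P T}"
  moreover from T have "finite T" "i \<notin> T"
    using assms finite_subset by blast+
  ultimately show "insert i T \<in> {T. T \<subseteq> S \<and> card T = Suc j \<and> i \<in> T \<and> Q T}"
    using assms by auto
qed (auto simp: insert_absorb)

lemma minor_sum_at_Suc:
  assumes "finite S" "i \<in> S"
  shows "minor_sum_at a S i (Suc j) = a i i * minor_sum a (S - {i}) j
           - (\<Sum>l\<in>S - {i}. \<Sum>m\<in>S - {i}. a i l * a m i * cofactor_sum a (S - {i}) j m l)"
proof -
  let ?C = "S - {i}"
  let ?U = "{T. T \<subseteq> ?C \<and> card T = j}"
  have fin: "finite ?U"
    using assms by simp
  have "minor_sum_at a S i (Suc j) = (\<Sum>T\<in>?U. pminor a (insert i T))"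
    using sum_subsets_containing[OF assms, where P = "\<lambda>_. True" and Q = "\<lambda>_. True"]
    by (simp add: minor_sum_at_def)
  \<comment> \<open>The inner sums are extended from \<open>T\<close> to all of
    \<open>S - {i}\<close> by zeros; their ranges no longer depend on \<open>T\<close>, so the order
    of summation can be exchanged.\<close>
  also have "\<dots> = (\<Sum>T\<in>?U. a i i * pminor a T
      - (\<Sum>l\<in>?C. \<Sum>m\<in>?C. if m \<in> T \<and> l \<in> T then a i l * a m i * cofactor_on a T m l else 0))"
  proof (rule sum.cong[OF refl])
    fix T assume T: "T \<in> ?U"
    then have [simp]: "finite T" "insert i T - {i} = T" and sub: "T \<subseteq> ?C"
      using assms finite_subset by blast+
    have "pminor a (insert i T)
        = a i i * pminor a T - (\<Sum>l\<in>T. \<Sum>m\<in>T. a i l * a m i * cofactor_on a T m l)"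
      using pminor_expand_diagonal_entry[of "insert i T" i a] by simp
    also have "(\<Sum>l\<in>T. \<Sum>m\<in>T. a i l * a m i * cofactor_on a T m l)
        = (\<Sum>l\<in>?C. \<Sum>m\<in>?C. if m \<in> T \<and> l \<in> T then a i l * a m i * cofactor_on a T m l else 0)"
    proof (rule sum.mono_neutral_cong_left)
      show "(\<Sum>m\<in>T. a i l * a m i * cofactor_on a T m l)
          = (\<Sum>m\<in>?C. if m \<in> T \<and> l \<in> T then a i l * a m i * cofactor_on a T m l else 0)"
        if "l \<in> T" for l
        by (rule sum.mono_neutral_cong_left) (use assms sub that in auto)
    qed (use assms sub in auto)
    finally show "pminor a (insert i T) = a i i * pminor a T
      - (\<Sum>l\<in>?C. \<Sum>m\<in>?C. if m \<in> T \<and> l \<in> T then a i l * a m i * cofactor_on a T m l else 0)" .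
  qed
  also have "\<dots> = a i i * minor_sum a ?C j
      - (\<Sum>T\<in>?U. \<Sum>l\<in>?C. \<Sum>m\<in>?C. if m \<in> T \<and> l \<in> T then a i l * a m i * cofactor_on a T m l else 0)"
    by (simp add: sum_subtractf minor_sum_def sum_distrib_left)
  also have "(\<Sum>T\<in>?U. \<Sum>l\<in>?C. \<Sum>m\<in>?C. if m \<in> T \<and> l \<in> T then a i l * a m i * cofactor_on a T m l else 0)
      = (\<Sum>l\<in>?C. \<Sum>m\<in>?C. \<Sum>T\<in>?U. if m \<in> T \<and> l \<in> T then a i l * a m i * cofactor_on a T m l else 0)"
    by (subst sum.swap, intro sum.cong refl, subst sum.swap) (rule refl)
  also have "\<dots> = (\<Sum>l\<in>?C. \<Sum>m\<in>?C. a i l * a m i * cofactor_sum a ?C j m l)"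
    using fin by (intro sum.cong refl)
      (simp add: cofactor_sum_def sum_distrib_left sum.inter_filter[symmetric] conj_assoc)
  finally show ?thesis .
qed

lemma cofactor_sum_0: "finite S \<Longrightarrow> cofactor_sum a S 0 k l = 0"
  unfolding cofactor_sum_def by (rule sum.neutral) (auto dest: finite_subset)

lemma cofactor_sum_diag:
  assumes "finite S" "k \<in> S"
  shows "cofactor_sum a S (Suc j) k k = minor_sum a (S - {k}) j"
proof -
  have "cofactor_sum a S (Suc j) k k = (\<Sum>T | T \<subseteq> S - {k} \<and> card T = j. cofactor_on a (insert k T) k k)"
    using sum_subsets_containing[OF assms, where P = "\<lambda>_. True" and Q = "\<lambda>_. True"]
    by (simp add: cofactor_sum_def)
  also have "\<dots> = minor_sum a (S - {k}) j"
    unfolding minor_sum_def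
  proof (rule sum.cong[OF refl])
    fix T assume "T \<in> {T. T \<subseteq> S - {k} \<and> card T = j}"
    then have "insert k T - {k} = T"
      by auto
    then show "cofactor_on a (insert k T) k k = pminor a T"
      by (simp add: cofactor_on_diag)
  qed
  finally show ?thesis .
qed

lemma cofactor_sum_rec:
  assumes "finite S" "k \<in> S" "l \<in> S" "k \<noteq> l"
  shows "cofactor_sum a S (Suc j) k l
       = - (\<Sum>m\<in>S - {k}. a m k * cofactor_sum a (S - {k}) j m l)"
proof -
  let ?C = "S - {k}"
  let ?U = "{T. T \<subseteq> ?C \<and> card T = j \<and> l \<in> T}"
  have fin: "finite ?U"
    using assms by simp
  have "cofactor_sum a S (Suc j) k l = (\<Sum>T\<in>?U. cofactor_on a (insert k T) k l)"
    using sum_subsets_containing[OF assms(1,2), where P = "\<lambda>T. l \<in> T" and Q = "\<lambda>T. l \<in> T"] assms(4)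
    by (simp add: cofactor_sum_def)
  also have "\<dots> = (\<Sum>T\<in>?U. - (\<Sum>m\<in>?C. if m \<in> T then a m k * cofactor_on a T m l else 0))"
  proof (rule sum.cong[OF refl])
    fix T assume T: "T \<in> ?U"
    then have [simp]: "finite T" "insert k T - {k} = T" and sub: "T \<subseteq> ?C" and lT: "l \<in> T"
      using assms finite_subset by blast+
    have "cofactor_on a (insert k T) k l = - (\<Sum>m\<in>T. a m k * cofactor_on a T m l)"
      using cofactor_on_rec[of "insert k T" k l a] lT assms by simp
    also have "(\<Sum>m\<in>T. a m k * cofactor_on a T m l)
        = (\<Sum>m\<in>?C. if m \<in> T then a m k * cofactor_on a T m l else 0)"
      by (rule sum.mono_neutral_cong_left) (use assms sub in auto)
    finally show "cofactor_on a (insert k T) k l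
        = - (\<Sum>m\<in>?C. if m \<in> T then a m k * cofactor_on a T m l else 0)" .
  qed
  also have "\<dots> = - (\<Sum>m\<in>?C. \<Sum>T\<in>?U. if m \<in> T then a m k * cofactor_on a T m l else 0)"
    by (simp add: sum_negf) (rule sum.swap)
  also have "\<dots> = - (\<Sum>m\<in>?C. a m k * cofactor_sum a ?C j m l)"
    using fin by (intro arg_cong[where f = uminus] sum.cong refl)
      (simp add: cofactor_sum_def sum_distrib_left sum.inter_filter[symmetric] conj_ac)
  finally show ?thesis .
qed

text \<open>Double counting: a set of size \<open>j\<close> survives the deletion of exactly those
  \<open>card S - j\<close> indices that lie outside it.\<close>

lemma sum_minor_sum_delete:
  assumes "finite S"
  shows "(\<Sum>i\<in>S. minor_sum a (S - {i}) j) = of_nat (card S - j) * minor_sum a S j"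
proof -
  let ?U = "{T. T \<subseteq> S \<and> card T = j}"
  have "(\<Sum>i\<in>S. minor_sum a (S - {i}) j) = (\<Sum>i\<in>S. \<Sum>T\<in>?U. if i \<notin> T then pminor a T else 0)"
    unfolding minor_sum_def using assms
    by (intro sum.cong refl sum.mono_neutral_cong_left) auto
  also have "\<dots> = (\<Sum>T\<in>?U. \<Sum>i\<in>S. if i \<notin> T then pminor a T else 0)"
    by (rule sum.swap)
  also have "\<dots> = (\<Sum>T\<in>?U. of_nat (card S - j) * pminor a T)"
  proof (rule sum.cong[OF refl])
    fix T assume T: "T \<in> ?U"
    then have "card (S - T) = card S - j"
      using assms by (auto simp: card_Diff_subset finite_subset)
    moreover have "{i \<in> S. i \<notin> T} = S - T"
      by auto
    ultimately show "(\<Sum>i\<in>S. if i \<notin> T then pminor a T else 0) = of_nat (card S - j) * pminor a T"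
      using assms by (simp add: sum.inter_filter[symmetric])
  qed
  finally show ?thesis
    by (simp add: minor_sum_def sum_distrib_left)
qed

section \<open>Newton's inequalities for nonsingular M-matrices\<close>

text \<open>In the column recursion the coefficients \<open>- a m k\<close> are nonnegative, so the
  sign is inherited from smaller index sets, down to the diagonal cofactors, which are principal
  minors of proper subsets.\<close>

lemma cofactor_on_nonneg:
  fixes a :: "'a \<Rightarrow> 'a \<Rightarrow> real"
  assumes "finite S" "\<And>i j. i \<in> S \<Longrightarrow> j \<in> S \<Longrightarrow> i \<noteq> j \<Longrightarrow> a i j \<le> 0"
    and "\<And>T. T \<subset> S \<Longrightarrow> 0 \<le> pminor a T" "k \<in> S" "l \<in> S"
  shows "0 \<le> cofactor_on a S k l"
  using assms
proof (induction S arbitrary: k l rule: finite_psubset_induct)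
  case (psubset S)
  show ?case
  proof (cases "k = l")
    case True
    then show ?thesis
      using psubset.prems(2)[of "S - {k}"] psubset.prems(3) by (auto simp: cofactor_on_diag)
  next
    case False
    have "a m k * cofactor_on a (S - {k}) m l \<le> 0" if "m \<in> S - {k}" for m
    proof (rule mult_nonpos_nonneg)
      show "a m k \<le> 0"
        using psubset.prems that by blast
      show "0 \<le> cofactor_on a (S - {k}) m l"
        using that psubset.prems False by (intro psubset.IH) auto
    qed
    then show ?thesis
      using False psubset.prems psubset.hyps by (auto simp: cofactor_on_rec intro: sum_nonpos)
  qed
qed

text \<open>A Hadamard-Fischer type inequality: the double sum subtracted in
  \<open>pminor_expand_diagonal_entry\<close> is nonnegative. Asking only for nonnegative smaller
  minors makes it available at a zero of some minor.\<close>

lemma pminor_le_diagonal_mult: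
  fixes a :: "'a \<Rightarrow> 'a \<Rightarrow> real"
  assumes "finite S" "\<And>i j. i \<in> S \<Longrightarrow> j \<in> S \<Longrightarrow> i \<noteq> j \<Longrightarrow> a i j \<le> 0"
    and "\<And>T. T \<subset> S \<Longrightarrow> 0 \<le> pminor a T" "i \<in> S"
  shows "pminor a S \<le> a i i * pminor a (S - {i})"
proof -
  have "0 \<le> a i l * a m i * cofactor_on a (S - {i}) m l" if "l \<in> S - {i}" "m \<in> S - {i}" for l m
    using that assms by (intro mult_nonneg_nonneg mult_nonpos_nonpos cofactor_on_nonneg) auto
  then have "0 \<le> (\<Sum>l\<in>S - {i}. \<Sum>m\<in>S - {i}. a i l * a m i * cofactor_on a (S - {i}) m l)"
    by (intro sum_nonneg)
  then show ?thesis
    using assms by (simp add: pminor_expand_diagonal_entry[of S i])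
qed

section \<open>Nonsingular M-matrices and the signs of their minor and cofactor sums\<close>

definition nonsing_M_on :: "('a \<Rightarrow> 'a \<Rightarrow> real) \<Rightarrow> 'a set \<Rightarrow> bool" where
  "nonsing_M_on a S \<longleftrightarrow> finite S \<and> (\<forall>i\<in>S. \<forall>j\<in>S. i \<noteq> j \<longrightarrow> a i j \<le> 0) \<and> (\<forall>T\<subseteq>S. 0 < pminor a T)"

text \<open>For j > card S the binomial coefficient is 0, and so is the quotient.\<close>

definition minor_mean :: "('a \<Rightarrow> 'a \<Rightarrow> real) \<Rightarrow> 'a set \<Rightarrow> nat \<Rightarrow> real" where
  "minor_mean a S j = minor_sum a S j / real (card S choose j)"

lemma minor_sum_nonneg: "nonsing_M_on a S \<Longrightarrow> 0 \<le> minor_sum a S j"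
  unfolding minor_sum_def nonsing_M_on_def by (intro sum_nonneg) (auto intro: less_imp_le)

lemma minor_sum_pos:
  assumes "nonsing_M_on a S" "j \<le> card S"
  shows "0 < minor_sum a S j"
proof -
  obtain T where "T \<subseteq> S" "card T = j"
    using assms(2) by (metis obtain_subset_with_card_n)
  then show ?thesis
    using assms unfolding minor_sum_def nonsing_M_on_def by (intro sum_pos) auto
qed

lemma cofactor_sum_nonneg:
  assumes "nonsing_M_on a S" "k \<in> S" "l \<in> S"
  shows "0 \<le> cofactor_sum a S j k l"
  unfolding cofactor_sum_def
proof (rule sum_nonneg)
  fix T assume "T \<in> {T. T \<subseteq> S \<and> card T = j \<and> k \<in> T \<and> l \<in> T}"
  then show "0 \<le> cofactor_on a T k l"
    using assms unfolding nonsing_M_on_def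
    by (intro cofactor_on_nonneg) (auto intro: finite_subset less_imp_le)
qed

text \<open>Assumption \<open>P\<close> is the key fact for the deleted matrix, stated with
  derivatives and cleared of denominators. In \<open>minor_sum_at_Suc\<close> the terms with
  \<open>a i i\<close> contribute equally to both sides and cancel; the others carry the nonnegative
  weights \<open>a i l * a m i\<close>.\<close>

lemma minor_sum_at_ratio_le:
  assumes M: "nonsing_M_on a S" and i: "i \<in> S"
    and P: "\<And>k l. k \<in> S - {i} \<Longrightarrow> l \<in> S - {i} \<Longrightarrow>
      cofactor_sum a (S - {i}) j k l * minor_sum a (S - {i}) (Suc j)
        \<le> cofactor_sum a (S - {i}) (Suc j) k l * minor_sum a (S - {i}) j"
  shows "minor_sum a (S - {i}) j * minor_sum_at a S i (Suc (Suc j))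
       \<le> minor_sum a (S - {i}) (Suc j) * minor_sum_at a S i (Suc j)"
proof -
  let ?C = "S - {i}"
  let ?e = "minor_sum a ?C"
  let ?X = "\<lambda>j. \<Sum>l\<in>?C. \<Sum>m\<in>?C. a i l * a m i * cofactor_sum a ?C j m l"
  have fin: "finite S"
    using M by (simp add: nonsing_M_on_def)
  have "?X j * ?e (Suc j) \<le> ?X (Suc j) * ?e j"
    unfolding sum_distrib_right
  proof (intro sum_mono)
    fix l m assume lm: "l \<in> ?C" "m \<in> ?C"
    then have "0 \<le> a i l * a m i"
      using M i unfolding nonsing_M_on_def by (intro mult_nonpos_nonpos) auto
    from mult_left_mono[OF P[OF lm(2,1)] this]
    show "a i l * a m i * cofactor_sum a ?C j m l * ?e (Suc j)
        \<le> a i l * a m i * cofactor_sum a ?C (Suc j) m l * ?e j"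
      by (simp add: mult_ac)
  qed
  then show ?thesis
    unfolding minor_sum_at_Suc[OF fin i] by (simp add: algebra_simps)
qed

text \<open>With N = card S and J = j: p and q are the means of order j + 1 and j + 2 over S; x, y and z those
  of order j, j + 1 and j + 2 over S - {i}; u and v those over the minors that contain i, of order
  j + 1 and j + 2.\<close>

lemma newton_step_arith:
  fixes N J p q x y z u v :: real
  assumes "0 < N" "0 \<le> J" "J + 2 \<le> N"
    and "N * p = (N - J - 1) * y + (J + 1) * u"
    and "N * q = (N - J - 2) * z + (J + 2) * v"
    and "x * v \<le> y * u" "x * z \<le> y\<^sup>2"
  shows "(J + 1) * q * x \<le> (J + 2) * p * y - y\<^sup>2"
proof -
  have "N * ((J + 1) * q * x) = (J + 1) * x * (N * q)"
    by (simp add: algebra_simps)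
  also have "\<dots> = (J + 1) * (N - J - 2) * (x * z) + (J + 1) * (J + 2) * (x * v)"
    unfolding assms(5) by (simp add: algebra_simps)
  also have "\<dots> \<le> (J + 1) * (N - J - 2) * y\<^sup>2 + (J + 1) * (J + 2) * (y * u)"
    using assms by (intro add_mono mult_left_mono mult_nonneg_nonneg) auto
  \<comment> \<open>Here \<open>(J + 1) * (N - J - 2) = (J + 2) * (N - J - 1) - N\<close>, which is
    where the subtracted square comes from.\<close>
  also have "\<dots> = (J + 2) * y * ((N - J - 1) * y + (J + 1) * u) - N * y\<^sup>2"
    by (simp add: algebra_simps power2_eq_square)
  also have "\<dots> = N * ((J + 2) * p * y - y\<^sup>2)"
    unfolding assms(4)[symmetric] by (simp add: algebra_simps)
  finally show ?thesis
    using assms(1) by simp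
qed

lemma real_binomial_absorb:
  assumes "k \<le> Suc m"
  shows "(real (Suc m) - real k) * real (Suc m choose k) = real (Suc m) * real (m choose k)"
  using arg_cong[OF binomial_absorb_comp[of "Suc m" k], of real] assms
  by (simp only: of_nat_mult of_nat_diff diff_Suc_1)

lemma real_binomial_absorption:
  "real (Suc k) * real (Suc m choose Suc k) = real (Suc m) * real (m choose k)"
  using arg_cong[OF binomial_absorption[of k "Suc m"], of real]
  by (simp only: of_nat_mult diff_Suc_1)

lemma mult_divide_swap:
  fixes x y p q e :: real
  assumes "x * p = y * q" "p \<noteq> 0" "q \<noteq> 0"
  shows "x * (e / q) = y * (e / p)"
proof -
  have "x * e * p = x * p * e"
    by simp
  also have "\<dots> = y * e * q"
    unfolding assms(1) by simp
  finally show ?thesis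
    using assms(2,3) by (simp add: frac_eq_eq)
qed

text \<open>This is \<open>newton_step_arith\<close> applied to the means: \<open>P\<close> supplies
  the comparison of minors with and without \<open>i\<close>, and \<open>N\<close> is Newton's
  inequality for the deleted matrix.\<close>

lemma minor_mean_delete_le:
  assumes M: "nonsing_M_on a S" and i: "i \<in> S" and j: "Suc (Suc j) \<le> card S"
    and P: "\<And>k l. k \<in> S - {i} \<Longrightarrow> l \<in> S - {i} \<Longrightarrow>
      cofactor_sum a (S - {i}) j k l * minor_sum a (S - {i}) (Suc j)
        \<le> cofactor_sum a (S - {i}) (Suc j) k l * minor_sum a (S - {i}) j"
    and N: "minor_mean a (S - {i}) j * minor_mean a (S - {i}) (Suc (Suc j))
        \<le> (minor_mean a (S - {i}) (Suc j))\<^sup>2"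
  shows "(real j + 1) * minor_mean a S (Suc (Suc j)) * minor_mean a (S - {i}) j
    \<le> (real j + 2) * minor_mean a S (Suc j) * minor_mean a (S - {i}) (Suc j)
        - (minor_mean a (S - {i}) (Suc j))\<^sup>2"
proof -
  let ?C = "S - {i}"
  have fin: "finite S"
    using M by (simp add: nonsing_M_on_def)
  obtain m where n: "card S = Suc m"
    using j by (cases "card S") auto
  have m: "card ?C = m"
    using n i by simp
  \<comment> \<open>Sets of size \<open>k + 1\<close> containing \<open>i\<close> correspond to sets
    of size \<open>k\<close> in \<open>S - {i}\<close>, so \<open>b k\<close> is the mean of the
    minors of order \<open>k + 1\<close> that contain \<open>i\<close>.\<close>
  define b where "b k = minor_sum_at a S i (Suc k) / real (m choose k)" for k
  have split: "real (Suc m) * minor_mean a S (Suc k)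
      = (real (Suc m) - real (Suc k)) * minor_mean a ?C (Suc k) + real (Suc k) * b k"
    if k: "k \<le> m" for k
  proof -
    have B: "real (Suc m choose Suc k) \<noteq> 0" "real (m choose k) \<noteq> 0"
      using k by (simp_all del: binomial_Suc_Suc)
    have "real (Suc k) * b k = real (Suc m) * (minor_sum_at a S i (Suc k) / real (Suc m choose Suc k))"
      unfolding b_def by (rule mult_divide_swap[OF real_binomial_absorption B])
    moreover have "(real (Suc m) - real (Suc k)) * minor_mean a ?C (Suc k)
        = real (Suc m) * (minor_sum a ?C (Suc k) / real (Suc m choose Suc k))"
    \<comment> \<open>For \<open>k = m\<close> no minor of order \<open>k + 1\<close> avoids
      \<open>i\<close>, and both sides are 0. This boundary case occurs when
      \<open>j + 2 = card S\<close>.\<close>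
    proof (cases "k = m")
      case True
      then show ?thesis
        using minor_sum_eq_0[of ?C "Suc k" a] fin m by simp
    next
      case False
      then have "real (m choose Suc k) \<noteq> 0"
        using k by simp
      then show ?thesis
        unfolding minor_mean_def m using k
        by (intro mult_divide_swap real_binomial_absorb B) auto
    qed
    ultimately show ?thesis
      by (simp add: minor_mean_def n minor_sum_split[OF fin, of a _ i] algebra_simps add_divide_distrib del: of_nat_Suc)
  qed
  have "minor_sum a ?C j * minor_sum_at a S i (Suc (Suc j)) / (real (m choose j) * real (m choose Suc j))
      \<le> minor_sum a ?C (Suc j) * minor_sum_at a S i (Suc j) / (real (m choose j) * real (m choose Suc j))"
    by (intro divide_right_mono minor_sum_at_ratio_le M i P) auto
  then have ratio: "minor_mean a ?C j * b (Suc j) \<le> minor_mean a ?C (Suc j) * b j"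
    by (simp add: minor_mean_def b_def m mult_ac)
  show ?thesis
    by (rule newton_step_arith[where N = "real (Suc m)" and u = "b j" and v = "b (Suc j)"
          and z = "minor_mean a ?C (Suc (Suc j))"])
       (use split[of j] split[of "Suc j"] j n ratio N in \<open>auto simp: algebra_simps\<close>)
qed

text \<open>The key fact for the diagonal entry at \<open>i\<close>: by
  \<open>cofactor_sum_diag\<close> the sums over \<open>S - {i}\<close> are the derivatives with
  respect to \<open>a i i\<close>. It follows from \<open>le\<close> by discarding the
  square.\<close>

lemma minor_sum_delete_ratio_le:
  assumes M: "nonsing_M_on a S" and i: "i \<in> S"
    and le: "Suc (Suc j) \<le> card S \<Longrightarrow>
      (real j + 1) * minor_mean a S (Suc (Suc j)) * minor_mean a (S - {i}) j
      \<le> (real j + 2) * minor_mean a S (Suc j) * minor_mean a (S - {i}) (Suc j)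
        - (minor_mean a (S - {i}) (Suc j))\<^sup>2"
  shows "minor_sum a S (Suc (Suc j)) * minor_sum a (S - {i}) j
    \<le> minor_sum a S (Suc j) * minor_sum a (S - {i}) (Suc j)"
proof (cases "Suc (Suc j) \<le> card S")
  case True
  let ?C = "S - {i}"
  obtain m where n: "card S = Suc m"
    using True by (cases "card S") auto
  have m: "card ?C = m"
    using n i by simp
  let ?p = "real (Suc m choose Suc j)" and ?q = "real (m choose Suc j)"
  let ?p' = "real (Suc m choose Suc (Suc j))" and ?q' = "real (m choose j)"
  have pos: "?p > 0" "?q > 0" "?p' > 0" "?q' > 0"
    using True n by (auto simp del: binomial_Suc_Suc)
  have 1: "(real j + 2) * ?p' = real (Suc m) * ?q"
    using real_binomial_absorption[of "Suc j" m] by (simp add: algebra_simps)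
  have 2: "(real j + 1) * ?p = real (Suc m) * ?q'"
    using real_binomial_absorption[of "j" m] by (simp add: algebra_simps)
  have "real (Suc m) * ((real j + 1) * ?p * ?q) = (real j + 1) * ?p * (real (Suc m) * ?q)"
    by (simp only: mult_ac)
  also have "\<dots> = real (Suc m) * ?q' * ((real j + 2) * ?p')"
    by (simp only: 1 2)
  finally have "real (Suc m) * ((real j + 1) * ?p * ?q) = real (Suc m) * ((real j + 2) * ?p' * ?q')"
    by (simp only: mult_ac)
  \<comment> \<open>With this identity the factors \<open>j + 1\<close> and \<open>j + 2\<close>
    cancel against the binomial coefficients when means are turned back into sums.\<close>
  then have 3: "(real j + 1) * ?p * ?q = (real j + 2) * ?p' * ?q'"
    by (simp only: mult_cancel_left) simp
  have "(real j + 1) * minor_mean a S (Suc (Suc j)) * minor_mean a ?C j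
      \<le> (real j + 2) * minor_mean a S (Suc j) * minor_mean a ?C (Suc j)"
    using le[OF True] by (smt (verit) zero_le_power2)
  then have "(?p * ?q) * ((real j + 1) * (minor_sum a S (Suc (Suc j)) / ?p') * (minor_sum a ?C j / ?q'))
      \<le> (?p * ?q) * ((real j + 2) * (minor_sum a S (Suc j) / ?p) * (minor_sum a ?C (Suc j) / ?q))"
    using pos by (intro mult_left_mono) (auto simp: minor_mean_def n m)
  also have "\<dots> = (real j + 2) * (minor_sum a S (Suc j) * minor_sum a ?C (Suc j))"
    using pos by (simp del: binomial_Suc_Suc)
  also have "(?p * ?q) * ((real j + 1) * (minor_sum a S (Suc (Suc j)) / ?p') * (minor_sum a ?C j / ?q'))
      = ((real j + 1) * ?p * ?q) / (?p' * ?q') * (minor_sum a S (Suc (Suc j)) * minor_sum a ?C j)"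
    by (simp del: binomial_Suc_Suc)
  also have "((real j + 1) * ?p * ?q) / (?p' * ?q') = real j + 2"
    unfolding 3 using pos by (simp del: binomial_Suc_Suc)
  finally show ?thesis
    by (simp add: mult_le_cancel_left_pos)
next
  case False
  have "nonsing_M_on a (S - {i})"
    using M by (auto simp: nonsing_M_on_def)
  then have "0 \<le> minor_sum a S (Suc j) * minor_sum a (S - {i}) (Suc j)"
    using M by (intro mult_nonneg_nonneg minor_sum_nonneg)
  then show ?thesis
    using False M by (simp add: minor_sum_eq_0 nonsing_M_on_def)
qed

text \<open>The key fact for \<open>S\<close>. The diagonal case is \<open>D\<close>; off the
  diagonal, \<open>cofactor_sum_rec\<close> reduces it to the comparison \<open>step\<close>,
  weighted by \<open>- a m k\<close>, which is nonnegative.\<close>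

lemma cofactor_sum_ratio_le:
  assumes M: "nonsing_M_on a S" and k: "k \<in> S" and l: "l \<in> S"
    and P: "\<And>j m. m \<in> S - {k} \<Longrightarrow> l \<in> S - {k} \<Longrightarrow>
      cofactor_sum a (S - {k}) j m l * minor_sum a (S - {k}) (Suc j)
        \<le> cofactor_sum a (S - {k}) (Suc j) m l * minor_sum a (S - {k}) j"
    and D: "\<And>j. minor_sum a S (Suc (Suc j)) * minor_sum a (S - {k}) j
      \<le> minor_sum a S (Suc j) * minor_sum a (S - {k}) (Suc j)"
  shows "cofactor_sum a S j k l * minor_sum a S (Suc j)
    \<le> cofactor_sum a S (Suc j) k l * minor_sum a S j"
proof -
  have fin: "finite S" and MC: "nonsing_M_on a (S - {k})"
    using M by (auto simp: nonsing_M_on_def)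
  show ?thesis
  proof (cases j)
    case 0
    then show ?thesis
      using fin M k l by (simp add: cofactor_sum_0 cofactor_sum_nonneg minor_sum_nonneg)
  next
    case (Suc i)
    show ?thesis
    proof (cases "k = l")
      case True
      then show ?thesis
        using D[of i] fin k by (simp add: Suc cofactor_sum_diag mult_ac)
    next
      case False
      let ?C = "S - {k}"
      have lC: "l \<in> ?C"
        using False l by simp
      \<comment> \<open>The ratio e(i + 1) / e(i) of the deleted matrix mediates: \<open>D\<close>
        bounds e(j + 1) / e(j) of \<open>S\<close> by it, and \<open>P\<close> compares it with the
        ratio of the cofactor sums. Its denominator is positive and cancels at the end.\<close>
      have step: "cofactor_sum a ?C i m l * minor_sum a S (Suc j)
          \<le> cofactor_sum a ?C j m l * minor_sum a S j" if m: "m \<in> ?C" for m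
      proof (cases "Suc j \<le> card S")
        case True
        let ?g = "\<lambda>i. cofactor_sum a ?C i m l"
        have pos: "0 < minor_sum a ?C i"
          using True Suc k fin by (intro minor_sum_pos MC) auto
        have "?g i * minor_sum a S (Suc j) * minor_sum a ?C i
            = ?g i * (minor_sum a S (Suc (Suc i)) * minor_sum a ?C i)"
          by (simp add: Suc mult_ac)
        also have "\<dots> \<le> ?g i * (minor_sum a S (Suc i) * minor_sum a ?C (Suc i))"
          by (intro mult_left_mono D cofactor_sum_nonneg MC m lC)
        also have "\<dots> = minor_sum a S (Suc i) * (?g i * minor_sum a ?C (Suc i))"
          by simp
        also have "\<dots> \<le> minor_sum a S (Suc i) * (?g (Suc i) * minor_sum a ?C i)"
          by (intro mult_left_mono P m lC minor_sum_nonneg M)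
        also have "\<dots> = ?g j * minor_sum a S j * minor_sum a ?C i"
          by (simp add: Suc mult_ac)
        finally show ?thesis
          using pos by simp
      next
        case False
        then show ?thesis
          using fin M MC m lC by (simp add: minor_sum_eq_0 cofactor_sum_nonneg minor_sum_nonneg)
      qed
      have "- (a m k * cofactor_sum a ?C i m l * minor_sum a S (Suc j))
          \<le> - (a m k * cofactor_sum a ?C j m l * minor_sum a S j)" if m: "m \<in> ?C" for m
      proof -
        have "a m k \<le> 0"
          using M m k by (auto simp: nonsing_M_on_def)
        from mult_left_mono_neg[OF step[OF m] this] show ?thesis
          by (simp add: mult_ac)
      qed
      then have "(\<Sum>m\<in>?C. - (a m k * cofactor_sum a ?C i m l * minor_sum a S (Suc j)))
          \<le> (\<Sum>m\<in>?C. - (a m k * cofactor_sum a ?C j m l * minor_sum a S j))"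
        by (rule sum_mono)
      then show ?thesis
        using fin k l False Suc
        by (simp add: cofactor_sum_rec sum_distrib_right sum_negf)
    qed
  qed
qed

text \<open>Summing \<open>D\<close> over \<open>i\<close> replaces the deleted means by those of
  \<open>S\<close>. The sum of squares is at least \<open>card S\<close> times the square of their
  mean, which lowers the factor \<open>j + 2\<close> to \<open>j + 1\<close>; that factor then
  cancels.\<close>

lemma minor_mean_newton_sum:
  assumes M: "nonsing_M_on a S"
    and D: "\<And>i. i \<in> S \<Longrightarrow> Suc (Suc j) \<le> card S \<Longrightarrow>
      (real j + 1) * minor_mean a S (Suc (Suc j)) * minor_mean a (S - {i}) j
      \<le> (real j + 2) * minor_mean a S (Suc j) * minor_mean a (S - {i}) (Suc j)
        - (minor_mean a (S - {i}) (Suc j))\<^sup>2"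
  shows "minor_mean a S j * minor_mean a S (Suc (Suc j)) \<le> (minor_mean a S (Suc j))\<^sup>2"
proof (cases "Suc (Suc j) \<le> card S")
  case True
  have fin: "finite S"
    using M by (simp add: nonsing_M_on_def)
  obtain m where n: "card S = Suc m"
    using True by (cases "card S") auto
  have avg: "(\<Sum>i\<in>S. minor_mean a (S - {i}) k) = real (Suc m) * minor_mean a S k"
    if k: "k \<le> m" for k
  proof -
    have "(\<Sum>i\<in>S. minor_mean a (S - {i}) k) = (\<Sum>i\<in>S. minor_sum a (S - {i}) k) / real (m choose k)"
      using n by (simp add: minor_mean_def sum_divide_distrib)
    also have "\<dots> = (real (Suc m) - real k) * minor_sum a S k / real (m choose k)"
      using n fin k by (simp add: sum_minor_sum_delete of_nat_diff)
    also have "\<dots> = real (Suc m) * minor_mean a S k"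
      using mult_divide_swap[OF real_binomial_absorb[of k m], of "minor_sum a S k"] k n
      by (simp add: minor_mean_def del: of_nat_Suc binomial_Suc_Suc)
    finally show ?thesis .
  qed
  let ?c = "minor_mean a S" and ?x = "\<lambda>i. minor_mean a (S - {i})"
  have jm: "j \<le> m" "Suc j \<le> m"
    using True n by auto
  have "(\<Sum>i\<in>S. (real j + 1) * ?c (Suc (Suc j)) * ?x i j)
      \<le> (\<Sum>i\<in>S. (real j + 2) * ?c (Suc j) * ?x i (Suc j) - (?x i (Suc j))\<^sup>2)"
    by (intro sum_mono D True)
  then have 1: "(real j + 1) * ?c (Suc (Suc j)) * (real (Suc m) * ?c j)
      \<le> (real j + 2) * ?c (Suc j) * (real (Suc m) * ?c (Suc j)) - (\<Sum>i\<in>S. (?x i (Suc j))\<^sup>2)"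
    by (simp only: sum_subtractf sum_distrib_left[symmetric] avg[OF jm(1)] avg[OF jm(2)])
  \<comment> \<open>Cauchy-Schwarz in the form of a nonnegative variance, since
    \<open>?c (Suc j)\<close> is the average of the deleted means.\<close>
  have "0 \<le> (\<Sum>i\<in>S. (?x i (Suc j) - ?c (Suc j))\<^sup>2)"
    by (intro sum_nonneg) simp
  also have "\<dots> = (\<Sum>i\<in>S. (?x i (Suc j))\<^sup>2) - 2 * ?c (Suc j) * (\<Sum>i\<in>S. ?x i (Suc j))
      + real (card S) * (?c (Suc j))\<^sup>2"
    by (simp add: power2_diff sum.distrib sum_subtractf sum_distrib_left mult_ac)
  finally have 2: "real (Suc m) * (?c (Suc j))\<^sup>2 \<le> (\<Sum>i\<in>S. (?x i (Suc j))\<^sup>2)"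
    unfolding avg[OF jm(2)] n by (simp add: power2_eq_square algebra_simps)
  have "(real (Suc m) * (real j + 1)) * (?c j * ?c (Suc (Suc j)))
      \<le> (real (Suc m) * (real j + 1)) * (?c (Suc j))\<^sup>2"
    using 1 2 by (simp add: algebra_simps power2_eq_square)
  moreover have "0 < real (Suc m) * (real j + 1)"
    by (intro mult_pos_pos) auto
  ultimately show ?thesis
    by (simp only: mult_le_cancel_left_pos)
next
  case False
  then show ?thesis
    using binomial_eq_0[of "card S" "Suc (Suc j)"] by (simp only: minor_mean_def not_le) simp
qed

text \<open>Both conjuncts have to be carried along: the bound \<open>D\<close> for \<open>S\<close>
  uses Newton's inequality and the key fact for \<open>S - {i}\<close>, and each conjunct for
  \<open>S\<close> is then obtained from \<open>D\<close>.\<close>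

lemma nonsing_M_on_newton_aux:
  assumes "finite S" "nonsing_M_on a S"
  shows "(\<forall>j. minor_mean a S j * minor_mean a S (Suc (Suc j)) \<le> (minor_mean a S (Suc j))\<^sup>2) \<and>
    (\<forall>j. \<forall>k\<in>S. \<forall>l\<in>S. cofactor_sum a S j k l * minor_sum a S (Suc j)
        \<le> cofactor_sum a S (Suc j) k l * minor_sum a S j)"
  using assms
proof (induction S rule: finite_psubset_induct)
  case (psubset S)
  note M = psubset.prems
  have IH: "minor_mean a (S - {i}) j * minor_mean a (S - {i}) (Suc (Suc j))
        \<le> (minor_mean a (S - {i}) (Suc j))\<^sup>2"
      "\<And>k l. k \<in> S - {i} \<Longrightarrow> l \<in> S - {i} \<Longrightarrow> cofactor_sum a (S - {i}) j k l * minor_sum a (S - {i}) (Suc j)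
        \<le> cofactor_sum a (S - {i}) (Suc j) k l * minor_sum a (S - {i}) j"
    if "i \<in> S" for i j
  proof -
    have "S - {i} \<subset> S" "nonsing_M_on a (S - {i})"
      using that M by (auto simp: nonsing_M_on_def)
    note * = psubset.IH[OF this]
    show "minor_mean a (S - {i}) j * minor_mean a (S - {i}) (Suc (Suc j))
        \<le> (minor_mean a (S - {i}) (Suc j))\<^sup>2"
      using * by blast
    show "cofactor_sum a (S - {i}) j k l * minor_sum a (S - {i}) (Suc j)
        \<le> cofactor_sum a (S - {i}) (Suc j) k l * minor_sum a (S - {i}) j"
      if "k \<in> S - {i}" "l \<in> S - {i}" for k l
      using * that by blast
  qed
  have D: "(real j + 1) * minor_mean a S (Suc (Suc j)) * minor_mean a (S - {i}) j
      \<le> (real j + 2) * minor_mean a S (Suc j) * minor_mean a (S - {i}) (Suc j)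
        - (minor_mean a (S - {i}) (Suc j))\<^sup>2"
    if "i \<in> S" "Suc (Suc j) \<le> card S" for i j
    by (rule minor_mean_delete_le[OF M that IH(2)[OF that(1)] IH(1)[OF that(1)]])
  show ?case
  proof (intro conjI allI ballI)
    show "minor_mean a S j * minor_mean a S (Suc (Suc j)) \<le> (minor_mean a S (Suc j))\<^sup>2" for j
      by (rule minor_mean_newton_sum[OF M D])
    show "cofactor_sum a S j k l * minor_sum a S (Suc j) \<le> cofactor_sum a S (Suc j) k l * minor_sum a S j"
      if "k \<in> S" "l \<in> S" for j k l
      by (rule cofactor_sum_ratio_le[OF M that IH(2)[OF that(1)] minor_sum_delete_ratio_le[OF M that(1) D[OF that(1)]]])
  qed
qed

lemmas nonsing_M_on_newton = nonsing_M_on_newton_aux[THEN conjunct1, rule_format]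

section \<open>Shifts of nonnegative matrices\<close>

definition shifted :: "'b \<Rightarrow> ('a \<Rightarrow> 'a \<Rightarrow> 'b::comm_ring_1) \<Rightarrow> 'a \<Rightarrow> 'a \<Rightarrow> 'b" where
  "shifted x a = (\<lambda>i j. (if i = j then x else 0) - a i j)"

lemma pminor_shifted:
  assumes "finite S"
  shows "pminor (shifted x a) S = (\<Sum>T\<in>Pow S. x ^ card (S - T) * pminor (\<lambda>i j. - a i j) T)"
  using pminor_add_scalar[OF assms, of x "\<lambda>i j. - a i j"] by (simp add: shifted_def)

text \<open>The characteristic polynomial of the principal submatrix on \<open>S\<close>, written
  out by coefficients; as a polynomial it has finitely many zeros and obeys the intermediate value
  theorem.\<close>

definition char_poly_on :: "('a \<Rightarrow> 'a \<Rightarrow> 'b::comm_ring_1) \<Rightarrow> 'a set \<Rightarrow> 'b poly" where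
  "char_poly_on a S = (\<Sum>T\<in>Pow S. monom (pminor (\<lambda>i j. - a i j) T) (card (S - T)))"

lemma poly_char_poly_on:
  "finite S \<Longrightarrow> poly (char_poly_on a S) x = pminor (shifted x a) S"
  by (simp add: char_poly_on_def pminor_shifted poly_sum poly_monom mult.commute)

lemma lead_coeff_char_poly_on:
  assumes "finite S"
  shows "lead_coeff (char_poly_on a S) = 1"
proof -
  have "degree (char_poly_on a S) \<le> card S"
    unfolding char_poly_on_def using assms
    by (intro degree_sum_le) (auto intro!: order.trans[OF degree_monom_le] card_mono)
  moreover have "coeff (char_poly_on a S) (card S) = 1"
  proof -
    have "card (S - T) \<noteq> card S" if "T \<in> Pow S - {{}}" for T
      using that assms psubset_card_mono[of S "S - T"] by fastforce
    then have "coeff (char_poly_on a S) (card S)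
        = (\<Sum>T\<in>{{}}. if card (S - T) = card S then pminor (\<lambda>i j. - a i j) T else 0)"
      unfolding char_poly_on_def coeff_sum coeff_monom using assms
      by (intro sum.mono_neutral_right) auto
    then show ?thesis
      by simp
  qed
  ultimately show ?thesis
    by (metis le_degree le_antisym zero_neq_one)
qed

lemma poly_pos_if_no_roots_above:
  fixes p :: "real poly"
  assumes "0 < lead_coeff p" "\<And>x. r < x \<Longrightarrow> poly p x \<noteq> 0" "r < t"
  shows "0 < poly p t"
proof (rule ccontr)
  assume "\<not> 0 < poly p t"
  with assms have neg: "poly p t < 0"
    by (metis linorder_neqE_linordered_idom)
  obtain n where n: "\<And>x. n \<le> x \<Longrightarrow> lead_coeff p \<le> poly p x"
    using poly_pinfty_gt_lc[OF assms(1)] by blast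
  define u where "u = max n (t + 1)"
  have "0 < poly p u"
    using n[of u] assms(1) by (simp add: u_def)
  moreover have "t < u"
    by (simp add: u_def)
  ultimately obtain x where "t < x" "poly p x = 0"
    using poly_IVT_pos[of t u p] neg by blast
  then show False
    using assms(2)[of x] assms(3) by simp
qed

lemma shifted_pminor_pos:
  fixes a :: "'a \<Rightarrow> 'a \<Rightarrow> real"
  assumes fin: "finite S" and nonneg: "\<And>i j. i \<in> S \<Longrightarrow> j \<in> S \<Longrightarrow> i \<noteq> j \<Longrightarrow> 0 \<le> a i j"
    and no_root: "\<And>t. r < t \<Longrightarrow> pminor (shifted t a) S \<noteq> 0"
    and "T \<subseteq> S" "r < t"
  shows "0 < pminor (shifted t a) T"
proof -
  define R where "R = (\<Union>T\<in>Pow S. {x. poly (char_poly_on a T) x = 0})"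
  have fin_sub: "finite T" if "T \<subseteq> S" for T
    using that fin finite_subset by blast
  have lead: "0 < lead_coeff (char_poly_on a T)" if "T \<subseteq> S" for T
    using lead_coeff_char_poly_on[OF fin_sub[OF that], of a] by simp
  then have "char_poly_on a T \<noteq> 0" if "T \<subseteq> S" for T
    using that by (metis leading_coeff_0_iff less_irrefl)
  then have "finite R"
    unfolding R_def using fin by (intro finite_UN_I) (auto intro: poly_roots_finite)
  have "x \<le> r" if "x \<in> R" for x
  proof (rule ccontr)
    assume "\<not> x \<le> r"
    \<comment> \<open>The largest real zero among the characteristic polynomials of all principal
      submatrices; by the assumption on \<open>x\<close> it exceeds \<open>r\<close>.\<close>
    define s where "s = Max R"
    have s: "s \<in> R" "r < s"
      unfolding s_def using Max_in[OF \<open>finite R\<close>] Max_ge[OF \<open>finite R\<close> that] that \<open>\<not> x \<le> r\<close> by auto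
    have above: "0 < poly (char_poly_on a T) u" if "T \<subseteq> S" "s < u" for T u
    proof (rule poly_pos_if_no_roots_above[OF lead[OF that(1)] _ that(2)])
      fix y assume "s < y"
      then have "y \<notin> R"
        using Max_ge[OF \<open>finite R\<close>, of y] by (auto simp: s_def)
      then show "poly (char_poly_on a T) y \<noteq> 0"
        using that(1) by (auto simp: R_def)
    qed
    \<comment> \<open>Beyond \<open>s\<close> all these polynomials are positive, so a negative
      value at \<open>s\<close> would produce a further zero to the right.\<close>
    have ge0: "0 \<le> pminor (shifted s a) T" if T: "T \<subseteq> S" for T
    proof (rule ccontr)
      assume "\<not> 0 \<le> pminor (shifted s a) T"
      then have "poly (char_poly_on a T) s < 0"
        using T by (simp add: poly_char_poly_on fin_sub)
      then obtain y where "s < y" "poly (char_poly_on a T) y = 0"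
        using poly_IVT_pos[of s "s + 1" "char_poly_on a T"] above[OF T, of "s + 1"] by auto
      then show False
        using above[OF T, of y] by simp
    qed
    obtain T where T: "T \<subseteq> S" "pminor (shifted s a) T = 0"
      using s(1) by (auto simp: R_def poly_char_poly_on fin_sub)
    \<comment> \<open>Adding one index at a time, each new minor is squeezed between 0 and a
      diagonal entry times a vanishing minor. Taking \<open>D = S - T\<close> contradicts
      \<open>no_root\<close>.\<close>
    have "pminor (shifted s a) (T \<union> D) = 0" if "D \<subseteq> S - T" for D
    proof -
      have "finite D"
        using that fin finite_subset by blast
      then show ?thesis
        using that
      proof (induction D)
        case empty
        then show ?case
          using T by simp
      next
        case (insert i D)
        let ?U = "T \<union> insert i D"
        have U: "?U \<subseteq> S" "?U - {i} = T \<union> D"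
          using insert T by auto
        have "pminor (shifted s a) ?U \<le> shifted s a i i * pminor (shifted s a) (?U - {i})"
        proof (rule pminor_le_diagonal_mult)
          show "shifted s a k l \<le> 0" if "k \<in> ?U" "l \<in> ?U" "k \<noteq> l" for k l
            using that U(1) nonneg[of k l] by (auto simp: shifted_def)
          show "0 \<le> pminor (shifted s a) V" if "V \<subset> ?U" for V
            using that U(1) by (intro ge0) auto
        qed (use U fin_sub in auto)
        then show ?case
          using insert U ge0[OF U(1)] by simp
      qed
    qed
    from this[of "S - T"] have "pminor (shifted s a) S = 0"
      using T(1) by (simp add: Un_absorb1)
    then show False
      using no_root s(2) by blast
  qed
  then have "poly (char_poly_on a T) x \<noteq> 0" if "r < x" for x
    using that \<open>T \<subseteq> S\<close> by (force simp: R_def)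
  then have "0 < poly (char_poly_on a T) t"
    using poly_pos_if_no_roots_above[OF lead[OF \<open>T \<subseteq> S\<close>]] \<open>r < t\<close> by blast
  then show ?thesis
    using \<open>T \<subseteq> S\<close> by (simp add: poly_char_poly_on fin_sub)
qed

section \<open>Passage to the possibly singular limit\<close>

lemma isCont_pminor_shifted:
  fixes a :: "'a \<Rightarrow> 'a \<Rightarrow> real"
  shows "finite S \<Longrightarrow> isCont (\<lambda>t. pminor (shifted t a) S) r"
  unfolding pminor_shifted by (intro continuous_intros)

lemma isCont_nonneg_limit:
  fixes f :: "real \<Rightarrow> real"
  assumes "isCont f r" "\<And>t. r < t \<Longrightarrow> 0 \<le> f t"
  shows "0 \<le> f r"
proof (rule tendsto_lowerbound)
  show "(f \<longlongrightarrow> f r) (at_right r)"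
    using assms(1) by (simp add: isCont_def filterlim_at_split)
  show "\<forall>\<^sub>F t in at_right r. 0 \<le> f t"
    using eventually_at_right_less by (rule eventually_mono) (use assms(2) in auto)
qed simp

lemma minor_mean_shifted_newton:
  fixes a :: "'a \<Rightarrow> 'a \<Rightarrow> real"
  assumes fin: "finite S" and nonneg: "\<And>i j. i \<in> S \<Longrightarrow> j \<in> S \<Longrightarrow> i \<noteq> j \<Longrightarrow> 0 \<le> a i j"
    and no_root: "\<And>t. r < t \<Longrightarrow> pminor (shifted t a) S \<noteq> 0"
  shows "minor_mean (shifted r a) S j * minor_mean (shifted r a) S (Suc (Suc j))
    \<le> (minor_mean (shifted r a) S (Suc j))\<^sup>2"
proof -
  let ?c = "\<lambda>t. minor_mean (shifted t a) S"
  let ?f = "\<lambda>t. (?c t (Suc j))\<^sup>2 - ?c t j * ?c t (Suc (Suc j))"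
  have "isCont (\<lambda>t. ?c t k) r" for k
    unfolding minor_mean_def minor_sum_def divide_inverse
    by (intro continuous_intros isCont_pminor_shifted) (auto intro: finite_subset[OF _ fin])
  then have "isCont ?f r"
    by (intro continuous_intros)
  moreover have "0 \<le> ?f t" if "r < t" for t
  proof -
    have "nonsing_M_on (shifted t a) S"
      unfolding nonsing_M_on_def
    proof (intro conjI ballI allI impI fin)
      show "shifted t a i k \<le> 0" if "i \<in> S" "k \<in> S" "i \<noteq> k" for i k
        using that nonneg[of i k] by (simp add: shifted_def)
      show "0 < pminor (shifted t a) T" if "T \<subseteq> S" for T
        by (rule shifted_pminor_pos[OF fin nonneg no_root that \<open>r < t\<close>])
    qed
    from nonsing_M_on_newton[OF fin this, of j] show ?thesis
      by simp
  qed
  ultimately have "0 \<le> ?f r"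
    by (rule isCont_nonneg_limit)
  then show ?thesis
    by simp
qed

section \<open>Elementary symmetric polynomials and sums of principal minors\<close>

lemma sum_Pow_by_card:
  fixes x :: "'b::comm_semiring_1"
  assumes "finite S"
  shows "(\<Sum>T\<in>Pow S. g T * x ^ card (S - T))
       = (\<Sum>j\<le>card S. (\<Sum>T | T \<subseteq> S \<and> card T = j. g T) * x ^ (card S - j))"
    (is "_ = (\<Sum>j\<le>_. ?h j)")
proof -
  have "(\<Sum>T\<in>Pow S. g T * x ^ card (S - T))
      = (\<Sum>j\<le>card S. \<Sum>T | T \<in> Pow S \<and> card T = j. g T * x ^ card (S - T))"
    by (rule sum.group[symmetric]) (use assms in \<open>auto intro: card_mono\<close>)
  also have "\<dots> = (\<Sum>j\<le>card S. ?h j)"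
    unfolding sum_distrib_right using assms
    by (intro sum.cong) (auto simp: card_Diff_subset finite_subset)
  finally show ?thesis .
qed

text \<open>Vieta's formula. Compared with \<open>pminor_add_scalar_eq_minor_sum\<close>, it will
  identify the elementary symmetric polynomials of the eigenvalues with the sums of principal
  minors.\<close>

lemma prod_add_eq_elem_sym:
  "(\<Prod>i<length xs. x + xs ! i) = (\<Sum>j\<le>length xs. elem_sym xs j * x ^ (length xs - j))"
proof -
  have "(\<Prod>i<length xs. x + xs ! i) = (\<Sum>T\<in>Pow {..<length xs}. (\<Prod>i\<in>T. xs ! i) * x ^ card ({..<length xs} - T))"
    using prod_add[of "{..<length xs}" "\<lambda>i. xs ! i" "\<lambda>_. x"] by (simp add: add.commute)
  then show ?thesis
    by (simp add: sum_Pow_by_card elem_sym_def)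
qed

lemma pminor_add_scalar_eq_minor_sum:
  assumes "finite S"
  shows "pminor (\<lambda>i j. (if i = j then x else 0) + a i j) S
       = (\<Sum>j\<le>card S. minor_sum a S j * x ^ (card S - j))"
  using sum_Pow_by_card[OF assms, of "pminor a" x]
  by (simp add: pminor_add_scalar[OF assms] minor_sum_def mult.commute)

lemma rev_polyfun_eq_coeffs:
  fixes c d :: "nat \<Rightarrow> complex"
  assumes "\<And>x. (\<Sum>j\<le>n. c j * x ^ (n - j)) = (\<Sum>j\<le>n. d j * x ^ (n - j))" "j \<le> n"
  shows "c j = d j"
proof -
  have rev: "(\<Sum>j\<le>n. f j * x ^ (n - j)) = (\<Sum>j\<le>n. f (n - j) * x ^ j)" for f and x :: complex
    by (rule sum.reindex_bij_witness[where i = "\<lambda>j. n - j" and j = "\<lambda>j. n - j"]) auto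
  have "\<forall>x. (\<Sum>j\<le>n. c (n - j) * x ^ j) = (\<Sum>j\<le>n. d (n - j) * x ^ j)"
    using assms(1) by (simp add: rev)
  then have "\<forall>i\<le>n. c (n - i) = d (n - i)"
    by (simp only: polyfun_eq_coeffs)
  then show ?thesis
    using assms(2) by (metis diff_diff_cancel diff_le_self)
qed

section \<open>Translation to matrices, characteristic polynomials and spectra\<close>

lemma det_submatrix_eq_pminor:
  assumes A: "A \<in> carrier_mat n n" and I: "I \<subseteq> {..<n}"
  shows "det (submatrix A I I) = pminor (\<lambda>i j. A $$ (i, j)) I"
proof -
  have fin: "finite I"
    using I finite_subset by blast
  have eq: "{i. i < n \<and> i \<in> I} = I"
    using I by auto
  have carr: "submatrix A I I \<in> carrier_mat (card I) (card I)"
    using A by (intro carrier_matI) (auto simp: dim_submatrix eq)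
  have inj: "inj_on (pick I) {..<card I}"
    by (rule inj_onI) (metis card_pick_le lessThan_iff)
  have "pick I ` {..<card I} \<subseteq> I"
    by (auto intro: pick_in_set_le)
  \<comment> \<open>\<open>pick I\<close> enumerates \<open>I\<close> and thus renames the rows and
    columns of the submatrix to their original indices.\<close>
  then have img: "pick I ` {..<card I} = I"
    using fin inj by (intro card_subset_eq) (auto simp: card_image)
  have "det (submatrix A I I) = pminor (\<lambda>i j. submatrix A I I $$ (i, j)) {..<card I}"
    by (rule det_eq_pminor[OF carr])
  also have "\<dots> = pminor (\<lambda>i j. A $$ (pick I i, pick I j)) {..<card I}"
    using A by (intro pminor_cong submatrix_index) (auto simp: eq)
  also have "\<dots> = pminor (\<lambda>i j. A $$ (i, j)) I"
    using pminor_reindex[OF _ inj, of "\<lambda>i j. A $$ (i, j)"] by (simp add: img)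
  finally show ?thesis .
qed

lemma poly_char_poly_eq_pminor:
  fixes A :: "'b::field mat"
  assumes A: "A \<in> carrier_mat n n"
  shows "poly (char_poly A) x = pminor (shifted x (\<lambda>i j. A $$ (i, j))) {..<n}"
proof -
  have "poly (char_poly A) x = det (- char_matrix A x)"
    by (rule char_poly_matrix[OF A])
  also have "\<dots> = pminor (\<lambda>i j. (- char_matrix A x) $$ (i, j)) {..<n}"
    using A by (intro det_eq_pminor) auto
  also have "\<dots> = pminor (shifted x (\<lambda>i j. A $$ (i, j))) {..<n}"
    using A by (intro pminor_cong) (auto simp: char_matrix_def shifted_def)
  finally show ?thesis .
qed

text \<open>The characteristic polynomial is monic and splits over the complex numbers, so its
  multiset of zeros determines it.\<close>

lemma char_poly_spectrum:
  assumes A: "A \<in> carrier_mat n n" and L: "is_spectrum A L"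
  shows "char_poly (complex_mat A) = (\<Prod>z\<leftarrow>L. [:- z, 1:])" and "length L = n"
proof -
  have carr: "complex_mat A \<in> carrier_mat n n"
    using A by simp
  have L': "mset L = proots (char_poly (complex_mat A))"
    using L by (simp add: is_spectrum_def)
  have deg: "degree (char_poly (complex_mat A)) = n" "lead_coeff (char_poly (complex_mat A)) = 1"
    using degree_monic_char_poly[OF carr] by auto
  have "(\<Prod>z\<in>#mset L. [:- z, 1:]) = char_poly (complex_mat A)"
    using complex_poly_decompose_multiset[of "char_poly (complex_mat A)"] deg L' by simp
  then show "char_poly (complex_mat A) = (\<Prod>z\<leftarrow>L. [:- z, 1:])"
    by (simp add: prod_mset_prod_list[symmetric])
  show "length L = n"
    using arg_cong[OF L', of size] deg size_proots_complex[of "char_poly (complex_mat A)"] by simp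
qed

lemma is_spectrumI:
  assumes "char_poly (complex_mat A) = (\<Prod>z\<leftarrow>L. [:- z, 1:])"
  shows "is_spectrum A L"
proof -
  have "proots (\<Prod>z\<leftarrow>L. [:- z, 1:]) = mset L"
  proof (induction L)
    case (Cons z L)
    have "(\<Prod>z\<leftarrow>L. [:- z, 1:]) \<noteq> 0"
      by (auto simp: prod_list_zero_iff)
    then show ?case
      using Cons proots_mult[of "[:- z, 1:]" "\<Prod>z\<leftarrow>L. [:- z, 1:]"]
      by (simp del: mult_pCons_left)
  qed simp
  then show ?thesis
    by (simp add: is_spectrum_def assms)
qed

lemma prod_list_nth: "(\<Prod>z\<leftarrow>xs. f z) = (\<Prod>i<length xs. f (xs ! i))"
  by (simp add: prod.list_conv_set_nth atLeast0LessThan)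

text \<open>The predicate \<open>is_spectrum\<close> compares multisets, so the eigenvalue of
  largest modulus may be listed first; it enters as an embedded real number.\<close>

theorem mainTheorem3:
  fixes A :: "real mat" and n :: nat and \<rho> :: real and \<Lambda> :: "complex list"
  assumes "A \<in> carrier_mat n n"
    and "\<forall>i<n. \<forall>j<n. 0 \<le> A $$ (i, j)"
    and "is_spectrum A (complex_of_real \<rho> # \<Lambda>)"
    and "\<rho> = Max (cmod ` set (complex_of_real \<rho> # \<Lambda>))"
  shows "\<rho> = spectral_radius (complex_mat A)
    \<and> M_matrix (\<rho> \<cdot>\<^sub>m 1\<^sub>m n - A)
    \<and> is_spectrum (\<rho> \<cdot>\<^sub>m 1\<^sub>m n - A) (0 # map (\<lambda>z. complex_of_real \<rho> - z) \<Lambda>)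
    \<and> length (0 # map (\<lambda>z. complex_of_real \<rho> - z) \<Lambda>) = n
    \<and> newton_inequalities (0 # map (\<lambda>z. complex_of_real \<rho> - z) \<Lambda>)"
proof -
  define L where "L = complex_of_real \<rho> # \<Lambda>"
  define L' where "L' = map (\<lambda>z. complex_of_real \<rho> - z) L"
  define a where "a = (\<lambda>i j. A $$ (i, j))"
  define B where "B = \<rho> \<cdot>\<^sub>m 1\<^sub>m n - A"
  let ?S = "{..<n}"
  let ?M = "shifted \<rho> a"
  have L'_eq: "0 # map (\<lambda>z. complex_of_real \<rho> - z) \<Lambda> = L'"
    by (simp add: L'_def L_def)
  note A = assms(1)
  have carr: "complex_mat A \<in> carrier_mat n n" and B: "B \<in> carrier_mat n n"
      and carrB: "complex_mat B \<in> carrier_mat n n"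
    using A by (auto simp: B_def)
  have B_entry: "B $$ (i, j) = ?M i j" if "i < n" "j < n" for i j
    using that A by (auto simp: B_def shifted_def a_def)
  have spec: "is_spectrum A L"
    using assms(3) by (simp add: L_def)
  note cp = char_poly_spectrum(1)[OF A spec] and len = char_poly_spectrum(2)[OF A spec]
  have len': "length L' = n"
    by (simp add: L'_def len)
  have rho: "\<rho> = Max (cmod ` set L)"
    using assms(4) by (simp add: L_def)
  have set_L: "{z. poly (char_poly (complex_mat A)) z = 0} = set L"
    unfolding cp by (auto simp: poly_prod_list prod_list_zero_iff)
  have radius: "\<rho> = spectral_radius (complex_mat A)"
    unfolding spectral_radius_def spectrum_root_char_poly[OF carr] set_L by (rule rho)

  have entry: "complex_of_real (pminor (shifted t a) ?S) = poly (char_poly (complex_mat A)) (complex_of_real t)" for t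
  proof -
    have "poly (char_poly (complex_mat A)) (complex_of_real t)
        = pminor (\<lambda>i j. complex_of_real (shifted t a i j)) ?S"
      unfolding poly_char_poly_eq_pminor[OF carr]
      using A by (intro pminor_cong) (auto simp: shifted_def a_def)
    then show ?thesis
      by (simp add: pminor_of_real)
  qed
  \<comment> \<open>A zero at \<open>t\<close> would be an eigenvalue of \<open>A\<close> of modulus
    greater than \<open>\<rho>\<close>.\<close>
  have no_root: "pminor (shifted t a) ?S \<noteq> 0" if "\<rho> < t" for t
  proof
    assume "pminor (shifted t a) ?S = 0"
    then have "complex_of_real t \<in> set L"
      using entry[of t] set_L by auto
    then have "\<bar>t\<bar> \<le> \<rho>"
      unfolding rho by (intro Max_ge) (auto intro!: image_eqI[of _ _ "complex_of_real t"])
    with that show False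
      by simp
  qed
  have nonneg: "0 \<le> a i j" if "i \<in> ?S" "j \<in> ?S" "i \<noteq> j" for i j
    using that assms(2) by (simp add: a_def)

  have M: "M_matrix B"
    unfolding M_matrix_def
  proof (intro conjI allI impI)
    show "square_mat B"
      using B by simp
    show "0 \<le> det (submatrix B I I)" if I: "I \<subseteq> {..<dim_row B}" for I
    proof -
      have I: "I \<subseteq> ?S"
        using I B by simp
      have "det (submatrix B I I) = pminor ?M I"
        unfolding det_submatrix_eq_pminor[OF B I] using I
        by (intro pminor_cong B_entry) auto
      also have "0 \<le> \<dots>"
      proof (rule isCont_nonneg_limit[where f = "\<lambda>t. pminor (shifted t a) I"])
        show "isCont (\<lambda>t. pminor (shifted t a) I) \<rho>"
          using I finite_subset by (intro isCont_pminor_shifted) blast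
        show "0 \<le> pminor (shifted t a) I" if "\<rho> < t" for t
          using shifted_pminor_pos[OF _ nonneg no_root I that] by simp
      qed
      finally show ?thesis .
    qed
    show "B $$ (i, j) \<le> 0" if "i < dim_row B" "j < dim_row B" "i \<noteq> j" for i j
      using that B nonneg[of i j] by (simp add: B_entry shifted_def)
  qed

  \<comment> \<open>Both sides are the characteristic polynomial of \<open>A\<close> at
    \<open>x + \<rho>\<close>, because x I + (\<rho> I - A) = (x + \<rho>) I - A. This yields the
    spectrum of \<open>B\<close> and its elementary symmetric polynomials alike.\<close>
  have prod: "pminor (\<lambda>i j. (if i = j then x else 0) + complex_of_real (?M i j)) ?S
      = (\<Prod>i<length L'. x + L' ! i)" for x
  proof -
    have "(\<Prod>i<length L'. x + L' ! i) = (\<Prod>z\<leftarrow>L. (x + complex_of_real \<rho>) - z)"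
      unfolding prod_list_nth by (simp add: L'_def algebra_simps)
    also have "\<dots> = poly (char_poly (complex_mat A)) (x + complex_of_real \<rho>)"
      unfolding cp by (simp add: poly_prod_list o_def)
    also have "\<dots> = pminor (\<lambda>i j. (if i = j then x else 0) + complex_of_real (?M i j)) ?S"
      unfolding poly_char_poly_eq_pminor[OF carr]
      using A by (intro pminor_cong) (auto simp: shifted_def a_def)
    finally show ?thesis ..
  qed

  \<comment> \<open>Since x I - B = - ((- x) I + B), \<open>prod\<close> is applied at
    \<open>- x\<close>, and the sign (-1)^n is absorbed into the \<open>n\<close> factors.\<close>
  have "poly (char_poly (complex_mat B)) x = poly (\<Prod>z\<leftarrow>L'. [:- z, 1:]) x" for x
  proof -
    have "poly (char_poly (complex_mat B)) x
        = pminor (\<lambda>i j. - ((if i = j then - x else 0) + complex_of_real (?M i j))) ?S"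
      unfolding poly_char_poly_eq_pminor[OF carrB]
      using B by (intro pminor_cong) (auto simp: B_entry shifted_def)
    also have "\<dots> = (-1) ^ n * (\<Prod>i<length L'. - x + L' ! i)"
      unfolding pminor_uminus[OF finite_lessThan] prod card_lessThan ..
    also have "\<dots> = (\<Prod>i<length L'. - (- x + L' ! i))"
      by (simp only: prod_uminus card_lessThan len')
    also have "\<dots> = poly (\<Prod>z\<leftarrow>L'. [:- z, 1:]) x"
      by (simp add: prod_list_nth poly_prod)
    finally show ?thesis .
  qed
  then have spec': "is_spectrum B L'"
    by (intro is_spectrumI) (simp add: poly_eq_poly_eq_iff[symmetric] fun_eq_iff)

  have elem: "elem_sym L' j = complex_of_real (minor_sum ?M ?S j)" if "j \<le> n" for j
  proof -
    have "elem_sym L' j = minor_sum (\<lambda>i j. complex_of_real (?M i j)) ?S j"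
    proof (rule rev_polyfun_eq_coeffs[OF _ that])
      show "(\<Sum>j\<le>n. elem_sym L' j * x ^ (n - j))
          = (\<Sum>j\<le>n. minor_sum (\<lambda>i j. complex_of_real (?M i j)) ?S j * x ^ (n - j))" for x
        using prod_add_eq_elem_sym[of x L'] prod[of x]
          pminor_add_scalar_eq_minor_sum[of ?S x "\<lambda>i j. complex_of_real (?M i j)"]
        by (simp add: len')
    qed
    then show ?thesis
      by (simp add: minor_sum_def pminor_of_real)
  qed
  then have coeff: "newton_coeff L' j = complex_of_real (minor_mean ?M ?S j)" if "j \<le> n" for j
    using that by (simp add: newton_coeff_def minor_mean_def len')
  have "newton_inequalities L'"
    unfolding newton_inequalities_def len'
  proof (intro conjI allI ballI impI)
    show "newton_coeff L' j \<in> \<real>" if "j \<le> n" for j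
      using that by (simp add: coeff)
    \<comment> \<open>The range of \<open>j\<close> keeps \<open>j - 1\<close>, \<open>j\<close> and
      \<open>j + 1\<close> between 0 and \<open>n\<close>, so \<open>coeff\<close> applies to all
      three.\<close>
    show "Re (newton_coeff L' (j - 1)) * Re (newton_coeff L' (j + 1)) \<le> (Re (newton_coeff L' j))\<^sup>2"
      if "j \<in> {1..n - 1}" for j
    proof -
      from that obtain i where "j = Suc i"
        by (cases j) auto
      moreover have "minor_mean ?M ?S i * minor_mean ?M ?S (Suc (Suc i)) \<le> (minor_mean ?M ?S (Suc i))\<^sup>2"
        by (rule minor_mean_shifted_newton[OF finite_lessThan nonneg no_root])
      ultimately show ?thesis
        using that by (simp add: coeff)
    qed
  qed
  then show ?thesis
    using radius M spec' len' unfolding L'_eq B_def by blast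
qed

end
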